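(* The functions $$f_F(\mathbf{x}) := -\log\det\left(X_C(\mathbf{x})\right)\quad\text{and}\quad g_F(\mathbf{x}) := \operatorname{Tr}\left(\left(X_C(\mathbf{x})\right)^{-p}\right)\ \text{ for } p\in\mathbb{R}_{>0}$$ are $L$-smooth on $\mathbf{x}\in\mathbb{R}^m_{\geq 0}$ with Lipschitz constants $$L_{f_F}=\left(\max_{i} (AA^\intercal)_{ii}\right) \frac{\|A\|_2^2}{\lambda_{\min}(C)^2}$$ and $$L_{g_F} = p(p+1) \left(\max_i (AA^\intercal)_{ii} \right)\frac{\|A\|_2^2}{\lambda_{\min}(C)^{2+p}},$$ respectively.
   Context: $A\in\mathbb{R}^{m\times n}$ is a matrix with rows $\mathbf{v}_1,\dots,\mathbf{v}_m\in\mathbb{R}^n$ and full column rank. $\mathbf{l}\in\mathbb{N}_0^m$ is a vector of lower bounds such that $n$ linearly independent rows of $A$ have non-zero lower bounds, and $C := A^\intercal \operatorname{diag}(\mathbf{l})A$, which is therefore positive definite. The Fusion information matrix is $X_C(\mathbf{x}) := C + A^\intercal\operatorname{diag}(\mathbf{x}-\mathbf{l})A$. Here $\operatorname{diag}(\mathbf{x})$ is the diagonal matrix with $\mathbf{x}$ on its diagonal, $\lambda_{\min}$ is the smallest eigenvalue, and $\|A\|_2$ is the spectral norm. Real powers of positive definite matrices are defined through the eigendecomposition. A differentiable function $h$ is $L$-smooth on a set $S$ (with Lipschitz constant $L$) if $\|\nabla h(\mathbf{x})-\nabla h(\mathbf{y})\|_2\le L\|\mathbf{x}-\mathbf{y}\|_2$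 for all $\mathbf{x},\mathbf{y}\in S$.
   Formalization: The smoothness is stated on the vectors x with x ≥ l componentwise instead of on all x ≥ 0, because X_C(x) = AᵀDiag(x)A is singular at x = 0 and the stated constants fail near 0 (e.g. A = (1), l = 1, f_F = −log x). *)

theory Defs
  imports "HOL-Analysis.Analysis"
begin

definition diag_mat :: "real^'n \<Rightarrow> real^'n^'n" where
  "diag_mat d = (\<chi> i j. if i = j then d $ i else 0)"

definition eigenvalues :: "real^'n^'n \<Rightarrow> real set" where
  "eigenvalues X = {\<mu>. \<exists>v. v \<noteq> 0 \<and> X *v v = \<mu> *\<^sub>R v}"

text \<open>Only meaningful when the set of real eigenvalues is nonempty, as for symmetric matrices.\<close>

definition lambda_min :: "real^'n^'n \<Rightarrow> real" where
  "lambda_min X = Min (eigenvalues X)"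

definition spectral_norm :: "real^'n^'m \<Rightarrow> real" where
  "spectral_norm A = onorm (\<lambda>v. A *v v)"

text \<open>
  Intended for positive definite matrices. The result does not depend on the chosen
  eigendecomposition, see \<open>matrix_powr_eq\<close> below.
\<close>

definition matrix_powr :: "real^'n^'n \<Rightarrow> real \<Rightarrow> real^'n^'n" where
  "matrix_powr X a = (THE Y. \<exists>Q d. orthogonal_matrix Q \<and>
     X = Q ** diag_mat d ** transpose Q \<and>
     Y = Q ** diag_mat (\<chi> i. (d $ i) powr a) ** transpose Q)"

definition L_smooth_on :: "real \<Rightarrow> 'a::real_inner set \<Rightarrow> ('a \<Rightarrow> real) \<Rightarrow> bool" where
  "L_smooth_on L S h \<longleftrightarrow>
     (\<exists>grad. (\<forall>x\<in>S. GDERIV h x :> grad x) \<and> L-lipschitz_on S grad)"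

definition fusion_prior :: "real^'n^'m \<Rightarrow> real^'m \<Rightarrow> real^'n^'n" where
  "fusion_prior A l = transpose A ** diag_mat l ** A"

definition fusion_info :: "real^'n^'m \<Rightarrow> real^'m \<Rightarrow> real^'m \<Rightarrow> real^'n^'n" where
  "fusion_info A l x = fusion_prior A l + transpose A ** diag_mat (x - l) ** A"

text \<open>
  Since the prior is \<open>A\<^sup>T diag(l) A\<close>, the matrix \<open>fusion_info A l x\<close> equals \<open>A\<^sup>T diag(x) A\<close>, which is
  singular for instance at \<open>x = 0\<close>. Smallest eigenvalues are bounded below by those of the prior
  when \<open>x \<ge> l\<close>, so this, rather than \<open>x \<ge> 0\<close>, is the natural domain.
\<close>

definition f_F :: "real^'n^'m \<Rightarrow> real^'m \<Rightarrow> real^'m \<Rightarrow> real" where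
  "f_F A l x = - ln (det (fusion_info A l x))"

definition g_F :: "real^'n^'m \<Rightarrow> real^'m \<Rightarrow> real \<Rightarrow> real^'m \<Rightarrow> real" where
  "g_F A l p x = trace (matrix_powr (fusion_info A l x) (- p))"

lemma diag_mat_mult_right: "(M ** diag_mat d) $ i $ j = M $ i $ j * d $ j"
  by (simp add: matrix_matrix_mult_def diag_mat_def if_distrib[of "\<lambda>x. _ * x"] cong: if_cong)

lemma diag_mat_mult_left: "(diag_mat d ** M) $ i $ j = d $ i * M $ i $ j"
  by (simp add: matrix_matrix_mult_def diag_mat_def if_distrib[of "\<lambda>x. x * _"] cong: if_cong)

lemma eigendecomposition_fun_unique:
  fixes Q R :: "real^'n^'n"
  assumes Q: "orthogonal_matrix Q" and R: "orthogonal_matrix R"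
    and eq: "Q ** diag_mat d ** transpose Q = R ** diag_mat e ** transpose R"
  shows "Q ** diag_mat (\<chi> i. \<phi> (d $ i)) ** transpose Q =
         R ** diag_mat (\<chi> i. \<phi> (e $ i)) ** transpose R"
proof -
  define M where "M = transpose R ** Q"
  note QR = Q[unfolded orthogonal_matrix_def] R[unfolded orthogonal_matrix_def]
  have "M ** diag_mat d = transpose R ** (Q ** diag_mat d ** transpose Q) ** Q"
    using QR by (simp add: M_def flip: matrix_mul_assoc)
  also have "\<dots> = (transpose R ** R) ** diag_mat e ** M"
    unfolding eq M_def by (simp only: matrix_mul_assoc)
  finally have "M ** diag_mat d = diag_mat e ** M"
    using QR by simp
  then have *: "M $ i $ j * d $ j = e $ i * M $ i $ j" for i j
    by (metis diag_mat_mult_left diag_mat_mult_right)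
  have "M $ i $ j = 0 \<or> d $ j = e $ i" for i j
    using *[of i j] by auto
  then have "M $ i $ j * \<phi> (d $ j) = \<phi> (e $ i) * M $ i $ j" for i j
    by (metis mult.commute mult_zero_left)
  then have M: "M ** diag_mat (\<chi> i. \<phi> (d $ i)) = diag_mat (\<chi> i. \<phi> (e $ i)) ** M"
    by (simp add: vec_eq_iff diag_mat_mult_left diag_mat_mult_right)
  have "Q ** diag_mat (\<chi> i. \<phi> (d $ i)) ** transpose Q
      = (R ** transpose R) ** Q ** diag_mat (\<chi> i. \<phi> (d $ i)) ** transpose Q"
    using QR by simp
  also have "\<dots> = R ** (M ** diag_mat (\<chi> i. \<phi> (d $ i))) ** transpose Q"
    by (simp only: M_def matrix_mul_assoc)
  also have "\<dots> = R ** diag_mat (\<chi> i. \<phi> (e $ i)) ** transpose R ** (Q ** transpose Q)"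
    unfolding M by (simp only: M_def matrix_mul_assoc)
  finally show ?thesis
    using QR by simp
qed

lemma matrix_powr_eq:
  assumes "orthogonal_matrix Q" and "X = Q ** diag_mat d ** transpose Q"
  shows "matrix_powr X a = Q ** diag_mat (\<chi> i. (d $ i) powr a) ** transpose Q"
  unfolding matrix_powr_def
proof (rule the_equality)
  show "\<exists>Q' d'. orthogonal_matrix Q' \<and> X = Q' ** diag_mat d' ** transpose Q' \<and>
      Q ** diag_mat (\<chi> i. (d $ i) powr a) ** transpose Q =
      Q' ** diag_mat (\<chi> i. (d' $ i) powr a) ** transpose Q'"
    using assms by blast
next
  fix Y
  assume "\<exists>Q' d'. orthogonal_matrix Q' \<and> X = Q' ** diag_mat d' ** transpose Q' \<and>
      Y = Q' ** diag_mat (\<chi> i. (d' $ i) powr a) ** transpose Q'"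
  then show "Y = Q ** diag_mat (\<chi> i. (d $ i) powr a) ** transpose Q"
    using assms eigendecomposition_fun_unique[where \<phi> = "\<lambda>t. t powr a"] by metis
qed

end

(* Both functions have the form h(x) = tr psi(T x), where T x = A^T diag(x) A is linear in x,
   psi = -ln for f_F and psi(t) = t^(-p) for g_F. The gradient of X -> tr psi(X) is psi'(X). If psi'
   is K-Lipschitz on an interval containing the spectra of X and Y, then in the mixed coordinates
   (eigenbasis of X on the left, eigenbasis of Y on the right) X - Y and psi'(X) - psi'(Y) become
   W_ij (a_i - b_j) and W_ij (psi'(a_i) - psi'(b_j)), so that
   |psi'(X) - psi'(Y)| <= K |X - Y| in the Frobenius norm. The same coordinates bound the
   remainder of the first-order expansion of tr psi by K |X - Y|^2, which gives differentiability.
   Finally |T x| <= |A|_2 max_i |v_i| |x|, and the adjoint of T, which maps psi'(T x) to the gradient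
   of h, has the same norm. *)

theory Submission
  imports Defs
begin

section \<open>The spectral theorem for real symmetric matrices\<close>

text \<open>Such a quadratic takes its minimum 0 at \<open>t = 0\<close>, so its derivative there
  vanishes. This serves as the first-order condition at a maximiser of a Rayleigh quotient.\<close>

lemma nonneg_quadratic_linear_coeff_0:
  fixes b c :: real
  assumes nn: "\<And>t. 0 \<le> b * t + c * t\<^sup>2" and c: "0 \<le> c"
  shows "b = 0"
proof -
  \<comment> \<open>At \<open>t = - b / (c + 1)\<close> the quadratic has the value
    \<open>- (b\<^sup>2 / (c + 1)\<^sup>2)\<close>; the added 1 keeps the denominator positive when
    \<open>c = 0\<close>.\<close>
  have "0 \<le> b * (- b / (c + 1)) + c * (- b / (c + 1))\<^sup>2"
    by (rule nn)
  also have "\<dots> = - (b\<^sup>2 / (c + 1)\<^sup>2)"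
    using c by (simp add: divide_simps) (simp add: algebra_simps power2_eq_square)
  finally show ?thesis
    using c by (simp add: divide_le_0_iff zero_le_power2)
qed

text \<open>The quadratic form of \<open>f\<close> has a maximiser on the compact unit sphere of
  \<open>S\<close>, and the vanishing first variation makes it an eigenvector.\<close>

lemma selfadjoint_eigenvector:
  fixes f :: "'a::euclidean_space \<Rightarrow> 'a"
  assumes lin: "linear f" and sym: "\<And>x y. f x \<bullet> y = x \<bullet> f y"
    and S: "subspace S" "S \<noteq> {0}" and inv: "\<And>x. x \<in> S \<Longrightarrow> f x \<in> S"
  obtains v \<mu> where "v \<in> S" "norm v = 1" "f v = \<mu> *\<^sub>R v"
proof -
  let ?K = "S \<inter> sphere 0 1"
  obtain x where x: "x \<in> S" "x \<noteq> 0"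
    using S subspace_0 by blast
  then have "x /\<^sub>R norm x \<in> ?K"
    using S by (simp add: subspace_scale)
  then have ne: "?K \<noteq> {}" by blast
  have "compact ?K"
    using closed_subspace[OF S(1)] by (simp add: closed_Int_compact)
  moreover have "continuous_on ?K (\<lambda>x. x \<bullet> f x)"
    using lin by (intro continuous_intros linear_continuous_on) (simp add: linear_conv_bounded_linear)
  ultimately obtain v where v: "v \<in> ?K" and max: "\<And>y. y \<in> ?K \<Longrightarrow> y \<bullet> f y \<le> v \<bullet> f v"
    using continuous_attains_sup[OF _ ne] by blast
  define \<mu> where "\<mu> = v \<bullet> f v"
  have vv: "v \<bullet> v = 1" and vS: "v \<in> S"
    using v by (auto simp: norm_eq_1)
  have le: "w \<bullet> f w \<le> \<mu> * (w \<bullet> w)" if "w \<in> S" for w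
  proof (cases "w = 0")
    case False
    have "(w /\<^sub>R norm w) \<bullet> f (w /\<^sub>R norm w) \<le> \<mu>"
      unfolding \<mu>_def using that False S by (intro max) (simp add: subspace_scale)
    then have "(w \<bullet> f w) / (norm w)\<^sup>2 \<le> \<mu>"
      by (simp add: linear_scale[OF lin] power2_eq_square divide_simps)
    then show ?thesis
      using False by (simp add: divide_simps power2_norm_eq_inner split: if_splits)
  qed simp
  \<comment> \<open>The residual \<open>w\<close> lies in \<open>S\<close>, so it is an admissible
    direction of variation. Along \<open>v + t *\<^sub>R w\<close> the gap in \<open>le\<close> is a
    nonnegative quadratic in \<open>t\<close> without constant term and with linear coefficient
    \<open>2 * (w \<bullet> w)\<close>; hence \<open>w = 0\<close>.\<close>
  define w where "w = \<mu> *\<^sub>R v - f v"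
  have wS: "w \<in> S"
    unfolding w_def using vS inv S(1) by (simp add: subspace_diff subspace_scale)
  have "2 * (w \<bullet> w) = 0"
  proof (rule nonneg_quadratic_linear_coeff_0)
    show "0 \<le> \<mu> * (w \<bullet> w) - w \<bullet> f w"
      using le[OF wS] by simp
    show "0 \<le> 2 * (w \<bullet> w) * t + (\<mu> * (w \<bullet> w) - w \<bullet> f w) * t\<^sup>2" for t
    proof -
      have "v + t *\<^sub>R w \<in> S"
        using vS wS S(1) by (simp add: subspace_add subspace_scale)
      from le[OF this] have "0 \<le> \<mu> * ((v + t *\<^sub>R w) \<bullet> (v + t *\<^sub>R w)) - (v + t *\<^sub>R w) \<bullet> f (v + t *\<^sub>R w)"
        by simp
      also have "\<dots> = 2 * t * (\<mu> * (w \<bullet> v) - w \<bullet> f v) + t\<^sup>2 * (\<mu> * (w \<bullet> w) - w \<bullet> f w)"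
        using sym[of v w] vv
        by (simp add: linear_add[OF lin] linear_scale[OF lin] inner_add_left inner_add_right \<mu>_def
            inner_commute algebra_simps power2_eq_square)
      also have "\<mu> * (w \<bullet> v) - w \<bullet> f v = w \<bullet> w"
        unfolding w_def by (simp add: inner_diff_right)
      finally show ?thesis by (simp add: algebra_simps)
    qed
  qed
  then have "f v = \<mu> *\<^sub>R v" by (simp add: w_def)
  with that v show thesis by auto
qed

text \<open>Splitting off a unit eigenvector \<open>v\<close> leaves its orthogonal complement in
  \<open>S\<close>, which has one dimension less and is again invariant, since
  \<open>f x \<bullet> v = x \<bullet> f v = 0\<close> for \<open>x\<close> orthogonal to
  \<open>v\<close>.\<close>

lemma selfadjoint_orthonormal_eigenbasis:
  fixes f :: "'a::euclidean_space \<Rightarrow> 'a"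
  assumes lin: "linear f" and sym: "\<And>x y. f x \<bullet> y = x \<bullet> f y"
    and "subspace S" and "\<And>x. x \<in> S \<Longrightarrow> f x \<in> S"
  shows "\<exists>B\<subseteq>S. finite B \<and> card B = dim S \<and> pairwise orthogonal B \<and>
           (\<forall>b\<in>B. norm b = 1 \<and> (\<exists>\<mu>. f b = \<mu> *\<^sub>R b))"
  using assms(3,4)
proof (induction "dim S" arbitrary: S)
  case 0
  then show ?case by (intro exI[of _ "{}"]) auto
next
  case (Suc n)
  then have "S \<noteq> {0}" by auto
  then obtain v \<mu> where v: "v \<in> S" "norm v = 1" "f v = \<mu> *\<^sub>R v"
    using selfadjoint_eigenvector[OF lin sym Suc.prems(1)] Suc.prems(2) by blast
  define S' where "S' = {y \<in> S. \<forall>x \<in> span {v}. orthogonal x y}"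
  have S': "S' = S \<inter> {y. orthogonal v y}"
    unfolding S'_def by (auto simp: orthogonal_def span_singleton)
  have "dim S' + dim (span {v}) = dim S"
    unfolding S'_def using Suc.prems(1) v(1)
    by (intro dim_subspace_orthogonal_to_vectors) (auto simp: span_minimal)
  moreover have "dim (span {v}) = 1"
    using v(2) by (auto simp: dim_insert)
  ultimately have "n = dim S'" using Suc.hyps(2) by simp
  moreover have "subspace S'"
    unfolding S' using Suc.prems(1) by (intro subspace_inter subspace_orthogonal_to_vector)
  moreover have "f x \<in> S'" if "x \<in> S'" for x
    using that Suc.prems(2) v(3) sym[of v x] by (auto simp: S' orthogonal_def)
  ultimately obtain B where B: "B \<subseteq> S'" "finite B" "card B = dim S'" "pairwise orthogonal B"
    "\<And>b. b \<in> B \<Longrightarrow> norm b = 1 \<and> (\<exists>\<mu>. f b = \<mu> *\<^sub>R b)"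
    using Suc.hyps(1) by metis
  have "v \<notin> B"
    using B(1) v(2) by (auto simp: S' orthogonal_def norm_eq_1)
  then show ?case
    using B v \<open>n = dim S'\<close> Suc.hyps(2)
    by (intro exI[of _ "insert v B"])
       (auto simp: S' pairwise_insert orthogonal_commute)
qed

text \<open>An orthonormal eigenbasis, enumerated by the index type, supplies the columns of
  \<open>Q\<close>; taken together, the eigenvector equations read
  \<open>X ** Q = Q ** diag_mat d\<close>.\<close>

theorem spectral_theorem:
  fixes X :: "real^'n^'n"
  assumes "transpose X = X"
  obtains Q d where "orthogonal_matrix Q" "X = Q ** diag_mat d ** transpose Q"
proof -
  have sym: "(X *v x) \<bullet> y = x \<bullet> (X *v y)" for x y
    by (metis assms dot_lmul_matrix transpose_matrix_vector)
  obtain B where B: "finite B" "card B = CARD('n)" "pairwise orthogonal B"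
    "\<And>b. b \<in> B \<Longrightarrow> norm b = 1 \<and> (\<exists>\<mu>. X *v b = \<mu> *\<^sub>R b)"
    using selfadjoint_orthonormal_eigenbasis[OF matrix_vector_mul_linear[of X] sym subspace_UNIV]
    by auto
  obtain g :: "'n \<Rightarrow> real^'n" where g: "bij_betw g UNIV B"
    using B(1,2) by (metis finite_same_card_bij finite_class.finite_UNIV)
  then have gB: "g i \<in> B" for i by (auto simp: bij_betw_def)
  obtain \<mu> where \<mu>: "\<And>i. X *v g i = \<mu> i *\<^sub>R g i"
    using B(4)[OF gB] by metis
  define Q where "Q = (\<chi> i j. g j $ i)"
  define d where "d = (\<chi> i. \<mu> i)"
  have col: "column j Q = g j" for j
    by (simp add: Q_def column_def vec_eq_iff)
  have Q: "orthogonal_matrix Q"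
    unfolding orthogonal_matrix_orthonormal_columns col
    using B(3,4) gB g by (metis (no_types, lifting) UNIV_I bij_betw_def inj_on_def pairwiseD)
  have "X ** Q = Q ** diag_mat d"
    using \<mu> by (simp add: vec_eq_iff diag_mat_mult_right d_def)
      (simp add: Q_def matrix_matrix_mult_def matrix_vector_mult_def mult.commute)
  then have "X ** (Q ** transpose Q) = Q ** diag_mat d ** transpose Q"
    by (simp add: matrix_mul_assoc)
  then have "X = Q ** diag_mat d ** transpose Q"
    using Q by (simp add: orthogonal_matrix_def)
  with Q that show thesis by blast
qed

section \<open>The Frobenius inner product\<close>

text \<open>The inner product of nested vectors is the Frobenius one. In trace form, the adjoints of
  left and right multiplication follow from associativity and cyclicity.\<close>

lemma inner_eq_trace: "M \<bullet> N = trace (transpose M ** N)" for M N :: "real^'n^'m"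
  unfolding inner_vec_def trace_def matrix_matrix_mult_def transpose_def
  by (simp, subst sum.swap, simp)

lemma inner_matrix_mult_left: "(A ** M) \<bullet> N = M \<bullet> (transpose A ** N)"
  for A :: "real^'n^'m" and M :: "real^'k^'n"
  by (simp add: inner_eq_trace matrix_transpose_mul matrix_mul_assoc)

lemma inner_matrix_mult_right: "(M ** B) \<bullet> N = M \<bullet> (N ** transpose B)"
  for M :: "real^'n^'m" and B :: "real^'k^'n"
  unfolding inner_eq_trace
  by (metis matrix_mul_assoc matrix_transpose_mul trace_mul_sym)

lemma norm_transpose: "norm (transpose M) = norm M" for M :: "real^'n^'m"
  unfolding norm_eq_sqrt_inner inner_eq_trace by (metis trace_mul_sym transpose_transpose)

lemma norm_orthogonal_mult_left:
  "orthogonal_matrix Q \<Longrightarrow> norm (Q ** M) = norm M" for M :: "real^'k^'n"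
  by (simp add: norm_eq_sqrt_inner inner_matrix_mult_left matrix_mul_assoc orthogonal_matrix_def)

lemma norm_orthogonal_mult_right:
  "orthogonal_matrix Q \<Longrightarrow> norm (M ** Q) = norm M" for M :: "real^'n^'k"
  by (simp add: norm_eq_sqrt_inner inner_matrix_mult_right orthogonal_matrix_def
      flip: matrix_mul_assoc)

lemma orthogonal_matrix_transpose_mult:
  "orthogonal_matrix Q \<Longrightarrow> orthogonal_matrix R \<Longrightarrow> orthogonal_matrix (transpose Q ** R)"
  for Q R :: "real^'n^'n"
  by (intro orthogonal_matrix_mul) (simp_all add: orthogonal_matrix_transpose)

text \<open>Cauchy-Schwarz in each row. It later turns a Frobenius bound on a perturbation into a
  bound on its quadratic form.\<close>

lemma norm_matrix_vector_mult_le: "norm (M *v v) \<le> norm M * norm v" for M :: "real^'n^'m"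
proof -
  have "norm (M *v v) \<le> L2_set (\<lambda>i. norm (M $ i) * norm v) UNIV"
    unfolding norm_vec_def[of "M *v v"]
    by (rule L2_set_mono) (auto simp: matrix_vector_mul_component Cauchy_Schwarz_ineq2)
  then show ?thesis
    by (simp add: norm_vec_def[of M] L2_set_left_distrib)
qed

lemma spectral_norm_nonneg: "0 \<le> spectral_norm A"
  unfolding spectral_norm_def by (intro onorm_pos_le) (simp add: linear_conv_bounded_linear[symmetric])

lemma spectral_norm: "norm (A *v v) \<le> spectral_norm A * norm v"
  unfolding spectral_norm_def by (intro onorm) (simp add: linear_conv_bounded_linear[symmetric])

lemma spectral_norm_transpose: "norm (transpose A *v w) \<le> spectral_norm A * norm w"
proof (cases "transpose A *v w = 0")
  case False
  have "(norm (transpose A *v w))\<^sup>2 = w \<bullet> (A *v (transpose A *v w))"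
    unfolding power2_norm_eq_inner by (simp add: dot_lmul_matrix)
  also have "\<dots> \<le> norm w * (spectral_norm A * norm (transpose A *v w))"
    by (meson norm_cauchy_schwarz order.trans mult_left_mono norm_ge_zero spectral_norm)
  finally show ?thesis
    using False by (simp add: power2_eq_square ac_simps)
qed (simp add: spectral_norm_nonneg)

text \<open>Multiplication by \<open>transpose A\<close> acts on each column of \<open>M\<close>
  separately. Mixing the two norms puts the spectral norm of \<open>A\<close>, rather than its
  Frobenius norm, into the final constants.\<close>

lemma norm_matrix_mult_le: "norm (transpose A ** M) \<le> spectral_norm A * norm M"
  for A :: "real^'n^'m" and M :: "real^'k^'m"
proof -
  have row: "(transpose M ** A) $ i = transpose A *v (transpose M $ i)" for i
    by (simp add: vec_eq_iff matrix_matrix_mult_def vector_matrix_mult_def)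
  have "norm (transpose A ** M) = norm (transpose M ** A)"
    using norm_transpose[of "transpose A ** M"] by (simp add: matrix_transpose_mul)
  also have "\<dots> \<le> L2_set (\<lambda>i. spectral_norm A * norm (transpose M $ i)) UNIV"
    unfolding norm_vec_def[of "transpose M ** A"] row
    by (rule L2_set_mono) (simp_all only: spectral_norm_transpose norm_ge_zero)
  also have "\<dots> = spectral_norm A * norm (transpose M)"
    by (simp add: norm_vec_def[of "transpose M"] L2_set_right_distrib spectral_norm_nonneg)
  finally show ?thesis by (simp add: norm_transpose)
qed

section \<open>Spectral functions of symmetric matrices\<close>

lemma matrix_mult_diff_left: "A ** (M - N) = A ** M - A ** N" for A :: "real^'n^'m"
  by (simp add: vec_eq_iff matrix_matrix_mult_def sum_subtractf right_diff_distrib)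

lemma matrix_mult_diff_right: "(M - N) ** B = M ** B - N ** B" for B :: "real^'k^'n"
  by (simp add: vec_eq_iff matrix_matrix_mult_def sum_subtractf left_diff_distrib)

lemma inner_transpose_matrix_vector: "v \<bullet> (transpose A *v w) = (A *v v) \<bullet> w" for A :: "real^'n^'m"
  by (metis dot_lmul_matrix vector_transpose_matrix)

lemma diag_mat_vector: "(diag_mat d *v u) $ i = d $ i * u $ i"
  by (simp add: matrix_vector_mult_def diag_mat_def if_distrib[of "\<lambda>x. x * _"] cong: if_cong)

text \<open>Together with the column version, this makes the squared entries a doubly stochastic
  matrix: the weights in \<open>spectral_trace_remainder\<close>.\<close>

lemma orthogonal_matrix_row_sum:
  fixes W :: "real^'n^'n"
  assumes "orthogonal_matrix W"
  shows "(\<Sum>j\<in>UNIV. (W $ i $ j)\<^sup>2) = 1"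
proof -
  have "norm (row i W) = 1"
    using assms orthogonal_matrix_orthonormal_rows by blast
  then show ?thesis
    by (simp add: norm_eq_1 inner_vec_def row_def power2_eq_square)
qed

lemma orthogonal_matrix_column_sum:
  fixes W :: "real^'n^'n"
  assumes "orthogonal_matrix W"
  shows "(\<Sum>i\<in>UNIV. (W $ i $ j)\<^sup>2) = 1"
  using orthogonal_matrix_row_sum[of "transpose W" j] assms
  unfolding orthogonal_matrix_transpose by (simp add: transpose_def)

text \<open>Two symmetric matrices are compared in mixed coordinates: eigenbasis of the first on the
  left, of the second on the right. There the difference of functions of the two matrices is an
  entrywise product.\<close>

lemma eigendecomposition_diff_norm:
  fixes Q R :: "real^'n^'n"
  assumes Q: "orthogonal_matrix Q" and R: "orthogonal_matrix R"
  shows "(norm (Q ** diag_mat a ** transpose Q - R ** diag_mat b ** transpose R))\<^sup>2 =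
    (\<Sum>i\<in>UNIV. \<Sum>j\<in>UNIV. ((transpose Q ** R) $ i $ j)\<^sup>2 * (a $ i - b $ j)\<^sup>2)"
    (is "(norm (?X - ?Y))\<^sup>2 = _")
proof -
  note QR = Q[unfolded orthogonal_matrix_def] R[unfolded orthogonal_matrix_def]
  have "transpose Q ** ?X ** R = (transpose Q ** Q) ** diag_mat a ** (transpose Q ** R)"
    by (simp only: matrix_mul_assoc)
  moreover have "transpose Q ** ?Y ** R = (transpose Q ** R) ** diag_mat b ** (transpose R ** R)"
    by (simp only: matrix_mul_assoc)
  ultimately have entry: "(transpose Q ** (?X - ?Y) ** R) $ i $ j =
      (transpose Q ** R) $ i $ j * (a $ i - b $ j)" for i j
    using QR by (simp add: matrix_mult_diff_left matrix_mult_diff_right diag_mat_mult_left diag_mat_mult_right algebra_simps)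
  have "norm (?X - ?Y) = norm (transpose Q ** (?X - ?Y) ** R)"
    using Q R by (simp add: norm_orthogonal_mult_left norm_orthogonal_mult_right orthogonal_matrix_transpose)
  then show ?thesis
    by (simp add: power2_norm_eq_inner) (simp add: inner_vec_def entry power_mult_distrib flip: power2_eq_square)
qed

text \<open>In the mixed coordinates the scalar Lipschitz bound applies to each pair
  \<open>a $ i\<close>, \<open>b $ j\<close> under the same weight, so the constant carries over
  without a dimension factor and without commutation.\<close>

lemma spectral_function_lipschitz:
  fixes Q R :: "real^'n^'n"
  assumes Q: "orthogonal_matrix Q" and R: "orthogonal_matrix R"
    and \<phi>: "K-lipschitz_on S \<phi>" and S: "\<And>i. a $ i \<in> S" "\<And>i. b $ i \<in> S"
  shows "norm (Q ** diag_mat (\<chi> i. \<phi> (a $ i)) ** transpose Q - R ** diag_mat (\<chi> i. \<phi> (b $ i)) ** transpose R)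
    \<le> K * norm (Q ** diag_mat a ** transpose Q - R ** diag_mat b ** transpose R)"
proof (rule power2_le_imp_le)
  show "0 \<le> K * norm (Q ** diag_mat a ** transpose Q - R ** diag_mat b ** transpose R)"
    using lipschitz_on_nonneg[OF \<phi>] by simp
  have "(\<phi> (a $ i) - \<phi> (b $ j))\<^sup>2 \<le> K\<^sup>2 * (a $ i - b $ j)\<^sup>2" for i j
    using lipschitz_onD[OF \<phi> S(1)[of i] S(2)[of j]] lipschitz_on_nonneg[OF \<phi>]
    by (simp add: dist_real_def abs_mult flip: power_mult_distrib abs_le_square_iff)
  then have "w\<^sup>2 * (\<phi> (a $ i) - \<phi> (b $ j))\<^sup>2 \<le> K\<^sup>2 * (w\<^sup>2 * (a $ i - b $ j)\<^sup>2)" for i j w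
    by (subst mult.left_commute) (intro mult_left_mono, simp_all)
  then show "(norm (Q ** diag_mat (\<chi> i. \<phi> (a $ i)) ** transpose Q - R ** diag_mat (\<chi> i. \<phi> (b $ i)) ** transpose R))\<^sup>2
    \<le> (K * norm (Q ** diag_mat a ** transpose Q - R ** diag_mat b ** transpose R))\<^sup>2"
    unfolding power_mult_distrib eigendecomposition_diff_norm[OF Q R] sum_distrib_left
    by (intro sum_mono) simp
qed

text \<open>The squared entries of \<open>W\<close> sum to one along rows and columns, so both
  traces and the linear term become double sums with these common weights. The remainder is then a
  weighted sum of scalar remainders at pairs of eigenvalues.\<close>

lemma spectral_trace_remainder:
  fixes Q R :: "real^'n^'n"
  assumes Q: "orthogonal_matrix Q" and R: "orthogonal_matrix R"
    and \<psi>: "\<And>s t. s \<in> S \<Longrightarrow> t \<in> S \<Longrightarrow> \<bar>\<psi> t - \<psi> s - \<phi> s * (t - s)\<bar> \<le> K * (s - t)\<^sup>2"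
    and S: "\<And>i. a $ i \<in> S" "\<And>i. b $ i \<in> S"
  shows "\<bar>(\<Sum>i\<in>UNIV. \<psi> (b $ i)) - (\<Sum>i\<in>UNIV. \<psi> (a $ i)) -
      (Q ** diag_mat (\<chi> i. \<phi> (a $ i)) ** transpose Q) \<bullet>
        (R ** diag_mat b ** transpose R - Q ** diag_mat a ** transpose Q)\<bar>
    \<le> K * (norm (Q ** diag_mat a ** transpose Q - R ** diag_mat b ** transpose R))\<^sup>2"
proof -
  define W where "W = transpose Q ** R"
  note QR = Q[unfolded orthogonal_matrix_def] R[unfolded orthogonal_matrix_def]
  have W: "orthogonal_matrix W"
    unfolding W_def by (rule orthogonal_matrix_transpose_mult[OF Q R])
  have inner_diag: "diag_mat d \<bullet> M = (\<Sum>i\<in>UNIV. d $ i * M $ i $ i)" for d and M :: "real^'n^'n"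
    by (simp add: inner_vec_def diag_mat_def if_distrib[of "\<lambda>x. x * _"] cong: if_cong)
  have conj: "(Q ** D ** transpose Q) \<bullet> M = D \<bullet> (transpose Q ** M ** Q)" for D M
    unfolding inner_matrix_mult_right[of "Q ** D"] inner_matrix_mult_left[of Q D]
    by (simp add: matrix_mul_assoc)
  have "transpose Q ** (Q ** diag_mat a ** transpose Q) ** Q =
      (transpose Q ** Q) ** diag_mat a ** (transpose Q ** Q)"
    by (simp only: matrix_mul_assoc)
  then have X: "transpose Q ** (Q ** diag_mat a ** transpose Q) ** Q = diag_mat a"
    using QR by simp
  have Y: "transpose Q ** (R ** diag_mat b ** transpose R) ** Q = W ** diag_mat b ** transpose W"
    unfolding W_def by (simp add: matrix_transpose_mul matrix_mul_assoc)
  \<comment> \<open>Seen in the eigenbasis of the first matrix, the second has weighted averages of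
    \<open>b\<close> on its diagonal; only the diagonal matters for the inner product with a
    diagonal matrix.\<close>
  have Yi: "(W ** diag_mat b ** transpose W) $ i $ i = (\<Sum>j\<in>UNIV. (W $ i $ j)\<^sup>2 * b $ j)" for i
    by (subst matrix_matrix_mult_def)
       (simp add: diag_mat_mult_right transpose_def power2_eq_square ac_simps)
  have row: "(\<Sum>j\<in>UNIV. (W $ i $ j)\<^sup>2 * c) = c" for i c
    by (simp add: orthogonal_matrix_row_sum[OF W] flip: sum_distrib_right)
  have col: "(\<Sum>i\<in>UNIV. (W $ i $ j)\<^sup>2 * c) = c" for j c
    by (simp add: orthogonal_matrix_column_sum[OF W] flip: sum_distrib_right)
  have "(Q ** diag_mat (\<chi> i. \<phi> (a $ i)) ** transpose Q) \<bullet>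
        (R ** diag_mat b ** transpose R - Q ** diag_mat a ** transpose Q) =
      (\<Sum>i\<in>UNIV. \<phi> (a $ i) * (\<Sum>j\<in>UNIV. (W $ i $ j)\<^sup>2 * b $ j)) - (\<Sum>i\<in>UNIV. \<phi> (a $ i) * a $ i)"
    unfolding conj matrix_mult_diff_left matrix_mult_diff_right X Y
    by (simp add: inner_diff_right inner_diag Yi) (simp add: diag_mat_def)
  also have "\<dots> = (\<Sum>i\<in>UNIV. \<Sum>j\<in>UNIV. (W $ i $ j)\<^sup>2 * (\<phi> (a $ i) * (b $ j - a $ i)))"
    by (simp add: right_diff_distrib sum_subtractf row) (simp add: sum_distrib_left mult.left_commute)
  finally have *: "(Q ** diag_mat (\<chi> i. \<phi> (a $ i)) ** transpose Q) \<bullet>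
        (R ** diag_mat b ** transpose R - Q ** diag_mat a ** transpose Q) = \<dots>" .
  \<comment> \<open>Column sums spread the trace over \<open>b\<close> to all pairs, row sums the
    trace over \<open>a\<close>.\<close>
  have b: "(\<Sum>i\<in>UNIV. \<psi> (b $ i)) = (\<Sum>i\<in>UNIV. \<Sum>j\<in>UNIV. (W $ i $ j)\<^sup>2 * \<psi> (b $ j))"
    by (subst sum.swap) (simp add: col)
  have a: "(\<Sum>i\<in>UNIV. \<psi> (a $ i)) = (\<Sum>i\<in>UNIV. \<Sum>j\<in>UNIV. (W $ i $ j)\<^sup>2 * \<psi> (a $ i))"
    by (simp add: row)
  have "(\<Sum>i\<in>UNIV. \<psi> (b $ i)) - (\<Sum>i\<in>UNIV. \<psi> (a $ i)) -
      (Q ** diag_mat (\<chi> i. \<phi> (a $ i)) ** transpose Q) \<bullet>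
        (R ** diag_mat b ** transpose R - Q ** diag_mat a ** transpose Q) =
    (\<Sum>i\<in>UNIV. \<Sum>j\<in>UNIV. (W $ i $ j)\<^sup>2 * (\<psi> (b $ j) - \<psi> (a $ i) - \<phi> (a $ i) * (b $ j - a $ i)))"
    unfolding * a b by (simp add: right_diff_distrib sum_subtractf)
  also have "\<bar>\<dots>\<bar> \<le> (\<Sum>i\<in>UNIV. \<Sum>j\<in>UNIV. \<bar>(W $ i $ j)\<^sup>2 * (\<psi> (b $ j) - \<psi> (a $ i) - \<phi> (a $ i) * (b $ j - a $ i))\<bar>)"
    by (intro order.trans[OF sum_abs] sum_mono sum_abs)
  also have "\<dots> \<le> (\<Sum>i\<in>UNIV. \<Sum>j\<in>UNIV. (W $ i $ j)\<^sup>2 * (K * (a $ i - b $ j)\<^sup>2))"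
    unfolding abs_mult abs_power2 by (intro sum_mono mult_left_mono \<psi> S) simp
  finally show ?thesis
    unfolding eigendecomposition_diff_norm[OF Q R] W_def by (simp add: sum_distrib_left ac_simps)
qed

section \<open>Eigenvalues and the smallest eigenvalue read off an eigendecomposition\<close>

lemma eigendecomposition_eigenvector:
  fixes Q :: "real^'n^'n"
  assumes "orthogonal_matrix Q"
  shows "norm (column i Q) = 1"
    and "(Q ** diag_mat d ** transpose Q) *v column i Q = (d $ i) *\<^sub>R column i Q"
proof -
  show "norm (column i Q) = 1"
    using assms orthogonal_matrix_orthonormal_columns by blast
  have Q: "column i Q = Q *v axis i 1"
    by (simp add: matrix_vector_mult_basis)
  have "(Q ** diag_mat d ** transpose Q) *v column i Q
      = Q *v (diag_mat d *v ((transpose Q ** Q) *v axis i 1))"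
    unfolding Q by (simp only: matrix_vector_mul_assoc matrix_mul_assoc)
  also have "(transpose Q ** Q) *v axis i 1 = axis i 1"
    using assms by (simp add: orthogonal_matrix_def)
  also have "diag_mat d *v axis i 1 = (d $ i) *\<^sub>R axis i 1"
    by (simp add: vec_eq_iff diag_mat_vector axis_def)
  finally show "(Q ** diag_mat d ** transpose Q) *v column i Q = (d $ i) *\<^sub>R column i Q"
    by (simp add: Q matrix_vector_mult_scaleR)
qed

lemma eigendecomposition_ge:
  fixes Q :: "real^'n^'n"
  assumes "orthogonal_matrix Q"
    and "\<And>v. m * (v \<bullet> v) \<le> v \<bullet> ((Q ** diag_mat d ** transpose Q) *v v)"
  shows "m \<le> d $ i"
proof -
  have "column i Q \<bullet> column i Q = 1"
    using eigendecomposition_eigenvector(1)[OF assms(1)] by (simp only: norm_eq_1)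
  with assms(2)[of "column i Q"] show ?thesis
    by (simp only: eigendecomposition_eigenvector(2)[OF assms(1)] inner_scaleR_right mult_1_right)
qed

text \<open>The eigenvalue set is the range of \<open>d\<close>, hence finite and nonempty, which
  gives \<open>Min\<close> its meaning.\<close>

lemma lambda_min_eigendecomposition:
  fixes Q :: "real^'n^'n"
  assumes Q: "orthogonal_matrix Q" and X: "X = Q ** diag_mat d ** transpose Q"
  shows "lambda_min X = (MIN i. d $ i)"
proof -
  have "eigenvalues X = range (($) d)"
  proof (intro equalityI subsetI)
    fix \<mu> assume "\<mu> \<in> range (($) d)"
    then obtain i where "\<mu> = d $ i" by blast
    then show "\<mu> \<in> eigenvalues X"
      using eigendecomposition_eigenvector[OF Q, where i = i] unfolding eigenvalues_def X
      by (auto intro!: exI[of _ "column i Q"])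
  next
    fix \<mu> assume "\<mu> \<in> eigenvalues X"
    then obtain v where v: "v \<noteq> 0" "X *v v = \<mu> *\<^sub>R v" by (auto simp: eigenvalues_def)
    \<comment> \<open>In the eigenbasis coordinates \<open>u\<close> of \<open>v\<close> the
      eigenvector equation reads \<open>d $ i * u $ i = \<mu> * u $ i\<close>, and some coordinate
      is non-zero.\<close>
    define u where "u = transpose Q *v v"
    have "Q *v u = (Q ** transpose Q) *v v"
      unfolding u_def by (simp only: matrix_vector_mul_assoc)
    then have "Q *v u = v" using Q by (simp add: orthogonal_matrix_def)
    then have "u \<noteq> 0" using v(1) by auto
    then obtain i where i: "u $ i \<noteq> 0" by (auto simp: vec_eq_iff)
    have "diag_mat d *v u = (transpose Q ** Q) *v (diag_mat d *v u)"
      using Q by (simp add: orthogonal_matrix_def)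
    also have "\<dots> = transpose Q *v (X *v v)"
      unfolding X u_def by (simp only: matrix_vector_mul_assoc matrix_mul_assoc)
    also have "\<dots> = \<mu> *\<^sub>R u"
      unfolding v(2) u_def by (simp only: matrix_vector_mult_scaleR)
    finally have "(diag_mat d *v u) $ i = \<mu> * u $ i" by simp
    moreover have "(diag_mat d *v u) $ i = d $ i * u $ i"
      by (rule diag_mat_vector)
    ultimately show "\<mu> \<in> range (($) d)" using i by auto
  qed
  then show ?thesis by (simp add: lambda_min_def)
qed

lemma lambda_min_le:
  fixes X :: "real^'n^'n"
  assumes "transpose X = X"
  shows "lambda_min X * (v \<bullet> v) \<le> v \<bullet> (X *v v)"
proof -
  obtain Q d where Q: "orthogonal_matrix Q" and X: "X = Q ** diag_mat d ** transpose Q"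
    using spectral_theorem[OF assms] .
  define u where "u = transpose Q *v v"
  have "lambda_min X \<le> d $ i" for i
    unfolding lambda_min_eigendecomposition[OF Q X] by (simp add: Min_le)
  then have "(\<Sum>i\<in>UNIV. lambda_min X * (u $ i)\<^sup>2) \<le> (\<Sum>i\<in>UNIV. d $ i * (u $ i)\<^sup>2)"
    by (intro sum_mono mult_right_mono) auto
  also have "\<dots> = u \<bullet> (diag_mat d *v u)"
    by (simp add: inner_vec_def diag_mat_vector power2_eq_square ac_simps)
  also have "\<dots> = v \<bullet> (X *v v)"
    unfolding X u_def using inner_transpose_matrix_vector[of v "transpose Q"]
    by (simp only: transpose_transpose flip: matrix_vector_mul_assoc)
  finally have "lambda_min X * (u \<bullet> u) \<le> v \<bullet> (X *v v)"
    by (simp add: sum_distrib_left inner_vec_def power2_eq_square)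
  moreover have "u \<bullet> u = v \<bullet> ((Q ** transpose Q) *v v)"
    unfolding u_def using inner_transpose_matrix_vector[of v "transpose Q"]
    by (simp only: transpose_transpose flip: matrix_vector_mul_assoc)
  ultimately show ?thesis using Q by (simp add: orthogonal_matrix_def)
qed

section \<open>Smoothness of spectral functions along a linear matrix pencil\<close>

text \<open>The mean value inequality for \<open>\<psi> z - \<phi> s * z\<close>, whose derivative
  \<open>\<phi> z - \<phi> s\<close> is at most \<open>K * \<bar>s - t\<bar>\<close> in absolute
  value on the segment. The usual factor 1/2 is given up, as the bound serves only to prove
  differentiability.\<close>

lemma lipschitz_derivative_remainder:
  fixes \<psi> \<phi> :: "real \<Rightarrow> real"
  assumes \<psi>: "\<And>t. 0 < t \<Longrightarrow> (\<psi> has_real_derivative \<phi> t) (at t)"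
    and \<phi>: "K-lipschitz_on {m..} \<phi>" and m: "0 < m" and st: "s \<in> {m..}" "t \<in> {m..}"
  shows "\<bar>\<psi> t - \<psi> s - \<phi> s * (t - s)\<bar> \<le> K * (s - t)\<^sup>2"
proof -
  have "norm ((\<psi> t - \<phi> s * t) - (\<psi> s - \<phi> s * s)) \<le> K * \<bar>s - t\<bar> * norm (t - s)"
  proof (rule field_differentiable_bound[where f' = "\<lambda>z. \<phi> z - \<phi> s"])
    show "convex (closed_segment s t)" by simp
    fix z assume z: "z \<in> closed_segment s t"
    then have zm: "z \<in> {m..}"
      using st by (auto simp: closed_segment_eq_real_ivl split: if_splits)
    show "((\<lambda>z. \<psi> z - \<phi> s * z) has_field_derivative \<phi> z - \<phi> s) (at z within closed_segment s t)"
      using zm m by (intro DERIV_subset[OF DERIV_diff[OF \<psi> DERIV_cmult_Id]]) auto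
    have "\<bar>\<phi> z - \<phi> s\<bar> \<le> K * \<bar>z - s\<bar>"
      using lipschitz_onD[OF \<phi> zm st(1)] by (simp add: dist_real_def)
    also have "\<dots> \<le> K * \<bar>s - t\<bar>"
      using z lipschitz_on_nonneg[OF \<phi>]
      by (intro mult_left_mono) (auto simp: closed_segment_eq_real_ivl split: if_splits)
    finally show "norm (\<phi> z - \<phi> s) \<le> K * \<bar>s - t\<bar>" by simp
  qed auto
  moreover have "\<psi> t - \<phi> s * t - (\<psi> s - \<phi> s * s) = \<psi> t - \<psi> s - \<phi> s * (t - s)"
    by (simp add: algebra_simps)
  moreover have "\<bar>s - t\<bar> * norm (t - s) = (s - t)\<^sup>2"
    by (simp add: abs_if power2_eq_square algebra_simps)
  ultimately show ?thesis
    by (simp only: mult.assoc real_norm_def)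
qed

lemma norm_adjoint_le:
  fixes T :: "'a::euclidean_space \<Rightarrow> 'b::euclidean_space"
  assumes "linear T" and "\<And>x. norm (T x) \<le> c * norm x" and "0 \<le> c"
  shows "norm (adjoint T y) \<le> c * norm y"
proof (cases "adjoint T y = 0")
  case False
  have "(norm (adjoint T y))\<^sup>2 = T (adjoint T y) \<bullet> y"
    unfolding power2_norm_eq_inner by (rule adjoint_works[OF assms(1)])
  also have "\<dots> \<le> c * norm (adjoint T y) * norm y"
    by (meson assms(2) norm_cauchy_schwarz order.trans mult_right_mono norm_ge_zero)
  finally show ?thesis
    using False by (simp add: power2_eq_square ac_simps)
qed (simp add: assms(3))

text \<open>The common form of both objectives: \<open>h x\<close> is the trace of \<psi> at
  \<open>T x\<close>, prescribed only where \<open>T x\<close> is positive definite. One factor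
  \<open>c\<close> comes from \<open>T\<close>, the other from its adjoint. \<open>K\<close> depends
  on the left end of the interval because differentiability is shown on a larger interval than the
  Lipschitz bound.\<close>

lemma spectral_function_L_smooth_on:
  fixes T :: "'a::euclidean_space \<Rightarrow> real^'n^'n"
  assumes T: "linear T" and sym: "\<And>x. transpose (T x) = T x"
    and c: "0 \<le> c" "\<And>x. norm (T x) \<le> c * norm x"
    and \<kappa>: "0 < \<kappa>" "\<And>x v. x \<in> S \<Longrightarrow> \<kappa> * (v \<bullet> v) \<le> v \<bullet> (T x *v v)"
    and \<psi>: "\<And>t. 0 < t \<Longrightarrow> (\<psi> has_real_derivative \<phi> t) (at t)"
    and \<phi>: "\<And>m. 0 < m \<Longrightarrow> (K m)-lipschitz_on {m..} \<phi>"
    and h: "\<And>x Q d. orthogonal_matrix Q \<Longrightarrow> T x = Q ** diag_mat d ** transpose Q \<Longrightarrow>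
      (\<And>i. 0 < d $ i) \<Longrightarrow> h x = (\<Sum>i\<in>UNIV. \<psi> (d $ i))"
  shows "L_smooth_on (c\<^sup>2 * K \<kappa>) S h"
proof -
  \<comment> \<open>One eigendecomposition is chosen for each \<open>x\<close>, with no continuity
    in \<open>x\<close>; the comparison lemmas accept any pair of eigenbases.\<close>
  obtain Q d where Q: "\<And>x. orthogonal_matrix (Q x)"
    and TQ: "\<And>x. T x = Q x ** diag_mat (d x) ** transpose (Q x)"
  proof -
    have "\<exists>Q d. orthogonal_matrix Q \<and> T x = Q ** diag_mat d ** transpose Q" for x
      using spectral_theorem[OF sym[of x]] by blast
    then show ?thesis using that by metis
  qed
  \<comment> \<open>\<open>\<Phi> x\<close> is \<phi> applied to the matrix \<open>T x\<close>; by
    the chain rule, its image under the adjoint of \<open>T\<close> is the expected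
    gradient.\<close>
  define \<Phi> where "\<Phi> x = Q x ** diag_mat (\<chi> i. \<phi> (d x $ i)) ** transpose (Q x)" for x
  define G where "G x = adjoint T (\<Phi> x)" for x
  have K0: "0 \<le> K m" if "0 < m" for m
    using lipschitz_on_nonneg[OF \<phi>[OF that]] .
  have T_diff: "norm (T x - T y) \<le> c * norm (x - y)" for x y
    using c(2)[of "x - y"] by (simp add: linear_diff[OF T])
  have d_ge: "m \<le> d x $ i" if "\<And>v. m * (v \<bullet> v) \<le> v \<bullet> (T x *v v)" for m x i
    using that by (intro eigendecomposition_ge[OF Q[of x]]) (simp add: TQ)
  have d_S: "\<kappa> \<le> d x $ i" if "x \<in> S" for x i
    using \<kappa>(2)[OF that] by (rule d_ge)
  have "GDERIV h x :> G x" if x: "x \<in> S" for x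
  proof -
    \<comment> \<open>Differentiability concerns a full neighbourhood of \<open>x\<close>, which may
      leave \<open>S\<close>. Within radius \<open>e\<close> the matrix moves by at most
      \<open>\<kappa> / 2\<close>, so the eigenvalues stay at least \<open>\<kappa> / 2\<close>; the
      added 1 covers \<open>c = 0\<close>.\<close>
    define e where "e = \<kappa> / (2 * (c + 1))"
    have e: "0 < e" using \<kappa>(1) c(1) by (simp add: e_def)
    have d_near: "\<kappa> / 2 \<le> d y $ i" if y: "dist y x < e" for y i
    proof (rule d_ge)
      fix v
      have "norm (T x - T y) \<le> c * e"
        using T_diff[of x y] y c(1) mult_left_mono[of "norm (x - y)" e c]
        by (simp add: dist_norm norm_minus_commute)
      also have "\<dots> \<le> \<kappa> / 2"
        using \<kappa>(1) c(1) by (simp add: e_def field_simps)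
      finally have *: "norm (T x - T y) \<le> \<kappa> / 2" .
      have "v \<bullet> ((T x - T y) *v v) \<le> norm v * (norm (T x - T y) * norm v)"
        by (meson norm_cauchy_schwarz norm_matrix_vector_mult_le norm_ge_zero mult_left_mono order.trans)
      also have "\<dots> = norm (T x - T y) * (v \<bullet> v)"
        by (simp add: dot_square_norm power2_eq_square)
      also have "\<dots> \<le> \<kappa> / 2 * (v \<bullet> v)"
        using * by (intro mult_right_mono) auto
      finally show "\<kappa> / 2 * (v \<bullet> v) \<le> v \<bullet> (T y *v v)"
        using \<kappa>(2)[OF x, of v] by (simp add: matrix_vector_mult_diff_rdistrib inner_diff_right)
    qed
    have h_near: "h y = (\<Sum>i\<in>UNIV. \<psi> (d y $ i))" if "dist y x < e" for y
      using d_near[OF that] \<kappa>(1) by (intro h[OF Q TQ]) (meson half_gt_zero less_le_trans)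
    \<comment> \<open>The constant at \<open>\<kappa> / 2\<close> does not affect the result: it
      only multiplies a remainder quadratic in \<open>norm (y - x)\<close>.\<close>
    let ?L = "K (\<kappa> / 2) * c\<^sup>2"
    have "(h has_derivative (\<lambda>u. u \<bullet> G x)) (at x)"
    proof (rule has_derivativeI_sandwich[OF e])
      show "bounded_linear (\<lambda>u. u \<bullet> G x)" by (rule bounded_linear_inner_left)
      show "((\<lambda>y. ?L * norm (y - x)) \<longlongrightarrow> 0) (at x)"
        by (auto intro!: tendsto_eq_intros)
      fix y assume y: "y \<noteq> x" "dist y x < e"
      have xe: "dist x x < e" using e by simp
      have "(y - x) \<bullet> G x = \<Phi> x \<bullet> (T y - T x)"
        unfolding G_def by (simp add: adjoint_works[OF T] linear_diff[OF T] inner_commute)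
      then have "h y - h x - (y - x) \<bullet> G x =
          (\<Sum>i\<in>UNIV. \<psi> (d y $ i)) - (\<Sum>i\<in>UNIV. \<psi> (d x $ i)) - \<Phi> x \<bullet> (T y - T x)"
        by (simp only: h_near[OF y(2)] h_near[OF xe])
      also have "\<bar>\<dots>\<bar> \<le> K (\<kappa> / 2) * (norm (T x - T y))\<^sup>2"
        unfolding \<Phi>_def TQ[of x] TQ[of y]
      proof (rule spectral_trace_remainder[OF Q Q])
        show "\<bar>\<psi> t - \<psi> s - \<phi> s * (t - s)\<bar> \<le> K (\<kappa> / 2) * (s - t)\<^sup>2"
          if "s \<in> {\<kappa> / 2..}" "t \<in> {\<kappa> / 2..}" for s t
          using \<kappa>(1) by (intro lipschitz_derivative_remainder[OF \<psi> \<phi> _ that]) auto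
      qed (use d_near[OF xe] d_near[OF y(2)] in simp_all)
      also have "\<dots> \<le> K (\<kappa> / 2) * (c * norm (x - y))\<^sup>2"
        using \<kappa>(1) T_diff by (intro mult_left_mono power_mono K0) auto
      also have "\<dots> = ?L * norm (y - x) * norm (y - x)"
        by (simp add: power2_eq_square norm_minus_commute)
      finally show "norm (h y - h x - (y - x) \<bullet> G x) / norm (y - x) \<le> ?L * norm (y - x)"
        using y(1) by (simp add: divide_le_eq)
    qed
    then show ?thesis by (simp add: gderiv_def)
  qed
  \<comment> \<open>For two points of \<open>S\<close> both spectra lie in
    \<open>{\<kappa>..}\<close>, so \<open>K \<kappa>\<close> itself applies.\<close>
  moreover have "(c\<^sup>2 * K \<kappa>)-lipschitz_on S G"
  proof (rule lipschitz_onI)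
    fix x y assume xy: "x \<in> S" "y \<in> S"
    have "norm (\<Phi> x - \<Phi> y) \<le> K \<kappa> * norm (T x - T y)"
      unfolding \<Phi>_def TQ[of x] TQ[of y]
      using spectral_function_lipschitz[OF Q Q \<phi>[OF \<kappa>(1)]] d_S xy by simp
    also have "\<dots> \<le> K \<kappa> * (c * norm (x - y))"
      by (intro mult_left_mono T_diff K0 \<kappa>(1))
    finally have \<Phi>: "norm (\<Phi> x - \<Phi> y) \<le> K \<kappa> * (c * norm (x - y))" .
    have "norm (G x - G y) \<le> c * norm (\<Phi> x - \<Phi> y)"
      unfolding G_def using norm_adjoint_le[OF T c(2,1)]
      by (simp add: adjoint_linear[OF T] flip: linear_diff)
    also have "\<dots> \<le> c * (K \<kappa> * (c * norm (x - y)))"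
      by (rule mult_left_mono[OF \<Phi> c(1)])
    finally show "dist (G x) (G y) \<le> c\<^sup>2 * K \<kappa> * dist x y"
      by (simp add: dist_norm power2_eq_square ac_simps)
  qed (simp add: K0 \<kappa>(1))
  ultimately show ?thesis
    unfolding L_smooth_on_def by blast
qed

section \<open>The Fusion information matrix\<close>

lemma diag_mat_pencil_entry:
  "(transpose A ** diag_mat x ** A) $ i $ j = (\<Sum>k\<in>UNIV. x $ k * (A $ k $ i * A $ k $ j))"
  for A :: "real^'n^'m"
  by (subst matrix_matrix_mult_def) (simp add: diag_mat_mult_right transpose_def ac_simps)

lemma linear_diag_mat_pencil: "linear (\<lambda>x. transpose A ** diag_mat x ** A)"
  for A :: "real^'n^'m"
  by (intro linearI) (simp_all add: vec_eq_iff diag_mat_pencil_entry sum.distrib distrib_right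
      sum_distrib_left mult.assoc)

lemma transpose_diag_mat_pencil: "transpose (transpose A ** diag_mat x ** A) = transpose A ** diag_mat x ** A"
  for A :: "real^'n^'m"
proof -
  have "transpose (transpose A ** diag_mat x ** A) $ i $ j = (transpose A ** diag_mat x ** A) $ j $ i" for i j
    unfolding transpose_def[of "_ ** _"] by simp
  then show ?thesis by (simp add: vec_eq_iff diag_mat_pencil_entry ac_simps)
qed

lemma fusion_info_eq: "fusion_info A l x = transpose A ** diag_mat x ** A"
  unfolding fusion_info_def fusion_prior_def
  using linear_add[OF linear_diag_mat_pencil, of A l "x - l"] by simp

lemma diag_mat_pencil_quadratic:
  "v \<bullet> ((transpose A ** diag_mat x ** A) *v v) = (\<Sum>k\<in>UNIV. x $ k * (A $ k \<bullet> v)\<^sup>2)"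
  for A :: "real^'n^'m"
proof -
  have "v \<bullet> ((transpose A ** diag_mat x ** A) *v v) = (A *v v) \<bullet> (diag_mat x *v (A *v v))"
    by (simp only: inner_transpose_matrix_vector flip: matrix_vector_mul_assoc)
  also have "\<dots> = (\<Sum>k\<in>UNIV. x $ k * ((A *v v) $ k)\<^sup>2)"
    by (simp add: inner_vec_def[of "A *v v"] diag_mat_vector power2_eq_square ac_simps)
  finally show ?thesis by (simp add: matrix_vector_mul_component)
qed

text \<open>Row \<open>i\<close> of \<open>diag_mat x ** A\<close> is row \<open>i\<close> of
  \<open>A\<close> scaled by \<open>x $ i\<close>, and the squared length of the latter is a
  diagonal entry of \<open>A ** transpose A\<close>. The remaining factor \<open>transpose A\<close>
  costs \<open>spectral_norm A\<close>.\<close>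

lemma norm_diag_mat_pencil:
  fixes A :: "real^'n^'m"
  shows "norm (transpose A ** diag_mat x ** A)
    \<le> spectral_norm A * sqrt (MAX i. (A ** transpose A) $ i $ i) * norm x"
proof -
  let ?M = "MAX i. (A ** transpose A) $ i $ i"
  have row: "(norm (A $ i))\<^sup>2 \<le> ?M" for i
  proof -
    have "(norm (A $ i))\<^sup>2 = (A ** transpose A) $ i $ i"
      by (simp add: power2_norm_eq_inner inner_vec_def matrix_matrix_mult_def transpose_def)
    also have "\<dots> \<le> ?M" by (rule Max_ge) auto
    finally show ?thesis .
  qed
  have M0: "0 \<le> ?M" using row order.trans zero_le_power2 by blast
  have "(norm (diag_mat x ** A))\<^sup>2 = (\<Sum>i\<in>UNIV. (x $ i)\<^sup>2 * (norm (A $ i))\<^sup>2)"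
    by (simp add: power2_norm_eq_inner)
       (simp add: inner_vec_def diag_mat_mult_left sum_distrib_left power2_eq_square ac_simps)
  also have "\<dots> \<le> (\<Sum>i\<in>UNIV. (x $ i)\<^sup>2 * ?M)"
    by (intro sum_mono mult_left_mono row) auto
  also have "\<dots> = (sqrt ?M * norm x)\<^sup>2"
    using M0 by (simp add: power_mult_distrib power2_norm_eq_inner flip: sum_distrib_right)
      (simp add: inner_vec_def power2_eq_square)
  finally have "norm (diag_mat x ** A) \<le> sqrt ?M * norm x"
    by (rule power2_le_imp_le) (simp add: M0)
  then have "spectral_norm A * norm (diag_mat x ** A) \<le> spectral_norm A * (sqrt ?M * norm x)"
    by (rule mult_left_mono) (rule spectral_norm_nonneg)
  with norm_matrix_mult_le[of A "diag_mat x ** A"] show ?thesis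
    by (simp add: matrix_mul_assoc mult.assoc)
qed

text \<open>With nonnegative weights, a non-positive form forces every term to vanish, so
  \<open>v\<close> is orthogonal to the rows indexed by \<open>I\<close>. These span the space, so
  \<open>v\<close> is orthogonal to itself.\<close>

lemma fusion_prior_pos_def:
  fixes A :: "real^'n^'m"
  assumes l: "\<And>i. l $ i \<in> \<nat>"
    and I: "card I = CARD('n)" "\<And>i. i \<in> I \<Longrightarrow> l $ i \<noteq> 0"
      "inj_on (\<lambda>i. row i A) I" "independent ((\<lambda>i. row i A) ` I)"
    and v: "v \<noteq> 0"
  shows "0 < v \<bullet> (fusion_prior A l *v v)"
proof (rule ccontr)
  have l0: "0 \<le> l $ i" for i
    using l[of i] by (auto elim: Nats_cases)
  assume "\<not> 0 < v \<bullet> (fusion_prior A l *v v)"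
  then have "(\<Sum>k\<in>UNIV. l $ k * (A $ k \<bullet> v)\<^sup>2) \<le> 0"
    by (simp add: fusion_prior_def diag_mat_pencil_quadratic)
  moreover have nn: "0 \<le> l $ k * (A $ k \<bullet> v)\<^sup>2" for k
    using l0 by simp
  ultimately have "(\<Sum>k\<in>UNIV. l $ k * (A $ k \<bullet> v)\<^sup>2) = 0"
    by (simp add: sum_nonneg order.antisym)
  then have "l $ k * (A $ k \<bullet> v)\<^sup>2 = 0" for k
    using nn by (simp add: sum_nonneg_eq_0_iff)
  then have orth: "A $ k \<bullet> v = 0" if "k \<in> I" for k
    using I(2)[OF that] by (metis mult_eq_0_iff power_eq_0_iff)
  let ?B = "(\<lambda>i. row i A) ` I"
  have "card ?B = dim (UNIV :: (real^'n) set)"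
    using I(1,3) by (simp add: card_image)
  then have "v \<in> span ?B"
    using card_eq_dim[of ?B UNIV] I(4) by (auto simp: independent_imp_finite)
  then have "orthogonal v v"
    by (rule orthogonal_to_span) (auto simp: orthogonal_def row_def orth inner_commute[of v])
  then show False using v by (simp add: orthogonal_def)
qed

text \<open>The quadratic form is monotone in the weights, so the prior, which is the case
  \<open>x = l\<close>, bounds it from below.\<close>

lemma lambda_min_fusion_info:
  fixes A :: "real^'n^'m"
  assumes "\<And>i. l $ i \<le> x $ i"
  shows "lambda_min (fusion_prior A l) * (v \<bullet> v) \<le> v \<bullet> (fusion_info A l x *v v)"
proof -
  have "lambda_min (fusion_prior A l) * (v \<bullet> v) \<le> v \<bullet> (fusion_prior A l *v v)"
    by (rule lambda_min_le) (simp add: fusion_prior_def transpose_diag_mat_pencil)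
  also have "\<dots> \<le> v \<bullet> (fusion_info A l x *v v)"
    unfolding fusion_prior_def fusion_info_eq diag_mat_pencil_quadratic
    by (intro sum_mono mult_right_mono assms) simp
  finally show ?thesis .
qed

lemma lambda_min_pos:
  fixes X :: "real^'n^'n"
  assumes "transpose X = X" and "\<And>v. v \<noteq> 0 \<Longrightarrow> 0 < v \<bullet> (X *v v)"
  shows "0 < lambda_min X"
proof -
  obtain Q d where Q: "orthogonal_matrix Q" and X: "X = Q ** diag_mat d ** transpose Q"
    using spectral_theorem[OF assms(1)] .
  have "0 < d $ i" for i
  proof -
    have "norm (column i Q) = 1" "X *v column i Q = (d $ i) *\<^sub>R column i Q"
      unfolding X using eigendecomposition_eigenvector[OF Q] by auto
    then show ?thesis
      using assms(2)[of "column i Q"] by (cases "column i Q = 0") (auto simp: norm_eq_1)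
  qed
  then show ?thesis
    by (simp add: lambda_min_eigendecomposition[OF Q X])
qed

section \<open>Log-determinant and trace of a power as sums over the eigenvalues\<close>

lemma ln_det_eigendecomposition:
  fixes Q :: "real^'n^'n"
  assumes "orthogonal_matrix Q" and "\<And>i. 0 < d $ i"
  shows "ln (det (Q ** diag_mat d ** transpose Q)) = (\<Sum>i\<in>UNIV. ln (d $ i))"
proof -
  have "det (Q ** diag_mat d ** transpose Q) = det (diag_mat d) * (det Q)\<^sup>2"
    by (simp add: det_mul det_transpose power2_eq_square)
  also have "(det Q)\<^sup>2 = 1"
    using det_orthogonal_matrix[OF assms(1)] by auto
  also have "det (diag_mat d) = (\<Prod>i\<in>UNIV. d $ i)"
    by (subst det_diagonal) (auto simp: diag_mat_def)
  finally show ?thesis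
    using assms(2) by (simp add: ln_prod less_imp_neq[symmetric])
qed

lemma trace_matrix_powr_eigendecomposition:
  assumes "orthogonal_matrix Q" and "X = Q ** diag_mat d ** transpose Q"
  shows "trace (matrix_powr X a) = (\<Sum>i\<in>UNIV. (d $ i) powr a)"
proof -
  have "trace (matrix_powr X a) = trace ((transpose Q ** Q) ** diag_mat (\<chi> i. (d $ i) powr a))"
    unfolding matrix_powr_eq[OF assms] by (metis matrix_mul_assoc trace_mul_sym)
  then show ?thesis
    using assms(1) by (simp add: orthogonal_matrix_def) (simp add: trace_def diag_mat_def)
qed

text \<open>The derivative has size \<open>q * t powr (- q - 1)\<close>, which does not increase
  with \<open>t\<close> and so is largest at the left end \<open>m\<close>.\<close>

lemma powr_lipschitz_on:
  fixes q :: real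
  assumes "0 \<le> q" "0 < m"
  shows "(q * m powr (- q - 1))-lipschitz_on {m..} (\<lambda>t. t powr (- q))"
proof (rule lipschitz_onI)
  fix x y assume "x \<in> {m..}" "y \<in> {m..}"
  have "norm (x powr (- q) - y powr (- q)) \<le> q * m powr (- q - 1) * norm (x - y)"
  proof (rule field_differentiable_bound[OF convex_real_interval(1)])
    fix z assume z: "z \<in> {m..}"
    then show "((\<lambda>t. t powr (- q)) has_field_derivative - q * z powr (- q - 1)) (at z within {m..})"
      using assms by (auto intro!: derivative_eq_intros)
    have "z powr (- q - 1) \<le> m powr (- q - 1)"
      using z assms by (intro powr_mono2') auto
    then show "norm (- q * z powr (- q - 1)) \<le> q * m powr (- q - 1)"
      using assms by (simp add: abs_mult mult_left_mono)
  qed fact+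
  then show "dist (x powr (- q)) (y powr (- q)) \<le> q * m powr (- q - 1) * dist x y"
    by (simp add: dist_norm)
qed (use assms in simp)

text \<open>Both parts instantiate \<open>spectral_function_L_smooth_on\<close> with \<kappa> the
  smallest eigenvalue of the prior. There \<open>K \<kappa>\<close> is the second derivative of
  \<psi> at \<kappa>: \<open>1 / t\<^sup>2\<close> for \<open>- ln t\<close>, and
  \<open>p * (p + 1) * t powr (- p - 2)\<close> for \<open>t powr (- p)\<close>.\<close>

theorem theorem1:
  fixes A :: "real^'n^'m" and l :: "real^'m"
  assumes "rank A = CARD('n)"
    and "\<And>i. l $ i \<in> \<nat>"
    and "\<exists>I. card I = CARD('n) \<and> (\<forall>i\<in>I. l $ i \<noteq> 0) \<and>
             inj_on (\<lambda>i. row i A) I \<and> independent ((\<lambda>i. row i A) ` I)"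
  shows "L_smooth_on
           ((MAX i. (A ** transpose A) $ i $ i) * (spectral_norm A)\<^sup>2 /
              (lambda_min (fusion_prior A l))\<^sup>2)
           {x. \<forall>i. l $ i \<le> x $ i} (f_F A l)
       \<and> (\<forall>p>0. L_smooth_on
           (p * (p + 1) * (MAX i. (A ** transpose A) $ i $ i) * (spectral_norm A)\<^sup>2 /
              (lambda_min (fusion_prior A l)) powr (2 + p))
           {x. \<forall>i. l $ i \<le> x $ i} (g_F A l p))"
proof -
  let ?C = "fusion_prior A l"
  let ?M = "MAX i. (A ** transpose A) $ i $ i"
  let ?S = "{x. \<forall>i. l $ i \<le> x $ i}"
  let ?c = "spectral_norm A * sqrt ?M"
  let ?T = "\<lambda>x. transpose A ** diag_mat x ** A"
  obtain I where I: "card I = CARD('n)" "\<And>i. i \<in> I \<Longrightarrow> l $ i \<noteq> 0"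
      "inj_on (\<lambda>i. row i A) I" "independent ((\<lambda>i. row i A) ` I)"
    using assms(3) by blast
  have "0 < lambda_min ?C"
    using fusion_prior_pos_def[OF assms(2) I]
    by (intro lambda_min_pos) (auto simp: fusion_prior_def transpose_diag_mat_pencil)
  note \<kappa> = this lambda_min_fusion_info[of l _ A, unfolded fusion_info_eq]
  have M0: "0 \<le> ?M"
  proof -
    have "0 \<le> (A ** transpose A) $ i $ i" for i
      by (simp add: matrix_matrix_mult_def transpose_def sum_nonneg)
    then show ?thesis by (auto simp: Max_ge_iff)
  qed
  then have c: "0 \<le> ?c" "?c\<^sup>2 = ?M * (spectral_norm A)\<^sup>2"
    by (simp_all add: spectral_norm_nonneg power_mult_distrib)
  \<comment> \<open>The pencil, \<open>c\<close>, \<kappa> and the domain are now fixed; \<psi>,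
    \<phi>, \<open>K\<close> and \<open>h\<close> stay open for the two uses.\<close>
  note smooth = spectral_function_L_smooth_on[OF linear_diag_mat_pencil transpose_diag_mat_pencil
      c(1) norm_diag_mat_pencil \<kappa>(1), of ?S, OF \<kappa>(2), unfolded c(2)]
  have "L_smooth_on (?M * (spectral_norm A)\<^sup>2 * (1 * lambda_min ?C powr (- 1 - 1))) ?S (f_F A l)"
  proof (rule smooth)
    show "((\<lambda>t. - ln t) has_real_derivative - (t powr (- 1))) (at t)" if "0 < t" for t :: real
      using that by (auto intro!: derivative_eq_intros simp: powr_minus_divide)
    show "(1 * m powr (- 1 - 1))-lipschitz_on {m..} (\<lambda>t. - (t powr (- 1)))" if "0 < m" for m :: real
      using powr_lipschitz_on[of 1 m] that by (simp add: lipschitz_on_minus_iff)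
    show "f_F A l x = (\<Sum>i\<in>UNIV. - ln (d $ i))"
      if "orthogonal_matrix Q" "?T x = Q ** diag_mat d ** transpose Q" "\<And>i. 0 < d $ i" for x Q d
      using ln_det_eigendecomposition[OF that(1,3)] that(2)
      by (simp add: f_F_def fusion_info_eq sum_negf)
  qed auto
  then have f: "L_smooth_on (?M * (spectral_norm A)\<^sup>2 / (lambda_min ?C)\<^sup>2) ?S (f_F A l)"
    using \<kappa>(1) by (simp add: powr_minus_divide powr_numeral)
  have "L_smooth_on (p * (p + 1) * ?M * (spectral_norm A)\<^sup>2 / (lambda_min ?C) powr (2 + p)) ?S (g_F A l p)"
    if p: "0 < p" for p
  proof -
    \<comment> \<open>The factor \<open>p\<close> comes from differentiating
      \<open>t powr (- p)\<close>, the rest from \<open>powr_lipschitz_on\<close> with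
      \<open>q = p + 1\<close>; the exponent \<open>- (p + 1) - 1\<close> equals
      \<open>- (2 + p)\<close>.\<close>
    have "L_smooth_on (?M * (spectral_norm A)\<^sup>2 * (p * ((p + 1) * lambda_min ?C powr (- (p + 1) - 1)))) ?S (g_F A l p)"
    proof (rule smooth)
      show "((\<lambda>t. t powr (- p)) has_real_derivative - p * t powr (- (p + 1))) (at t)" if "0 < t" for t
      proof -
        have "((\<lambda>t. t powr (- p)) has_real_derivative - p * t powr (- p - 1)) (at t)"
          using that by (auto intro!: derivative_eq_intros)
        then show ?thesis by (simp only: minus_add_distrib diff_conv_add_uminus)
      qed
      show "(p * ((p + 1) * m powr (- (p + 1) - 1)))-lipschitz_on {m..} (\<lambda>t. - p * t powr (- (p + 1)))"
        if "0 < m" for m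
        using lipschitz_on_cmult_real[OF powr_lipschitz_on[of "p + 1" m], of "- p"] that p by simp
      show "g_F A l p x = (\<Sum>i\<in>UNIV. (d $ i) powr (- p))"
        if "orthogonal_matrix Q" "?T x = Q ** diag_mat d ** transpose Q" "\<And>i. 0 < d $ i" for x Q d
        using trace_matrix_powr_eigendecomposition[OF that(1,2)] by (simp add: g_F_def fusion_info_eq)
    qed auto
    moreover have "lambda_min ?C powr (- (p + 1) - 1) = 1 / lambda_min ?C powr (2 + p)"
      by (simp add: powr_minus_divide[symmetric] algebra_simps)
    ultimately show ?thesis by (simp add: ac_simps)
  qed
  with f show ?thesis by blast
qed

end
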